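(* Let $n,t\in\mathbb N$ with $n,t\ge 1$ and $s'\in\{-t,-t+2,\ldots,t-2,t\}$. Then $$\frac{N_{s',t}}{|I_{1,s'}|}\le\frac{\left(\frac{t+|s'|}{2}\right)!}{n^{\lceil\frac{t+|s'|}{4}\rceil}}.$$ Hence, the ratio of the largest block size in the LDOI regime to the largest block size in the generic regime is given by $$\max_{s'}\frac{N_{s',t}}{|I_{1,s'}|}\le\max_{s'}\frac{\left(\frac{t+|s'|}{2}\right)!}{n^{\lceil\frac{t+|s'|}{4}\rceil}}\le\frac{t!}{n^{\lceil\frac t4\rceil}},$$ where the maxima are over $s'\in\{-t,-t+2,\ldots,t-2,t\}$.
   Context: For $\alpha\in\mathbb N^n$ (entries are nonnegative integers), $|\alpha|=\sum_i\alpha_i$; congruences of vectors modulo 2 are entrywise. For $s'\in[-t,t]$ with $s'\equiv t$ (mod 2), $$I_{1,s'}=\{(\alpha,\beta,\beta')\in(\mathbb N^n)^3:\ |\alpha|=1,\ |\beta+\beta'|=t,\ |\beta|-|\beta'|=s'\},$$ and $$N_{s',t}=\max_{(\tilde\alpha,\tilde\beta,\tilde\beta')\in I_{1,s'}}\left|\{(\alpha,\beta,\beta')\in I_{1,s'}:\ \alpha+\beta+\beta'\equiv\tilde\alpha+\tilde\beta+\tilde\beta'\ (\mathrm{mod}\ 2)\}\right|.$$ The semidefinite program modelling the level-$t$ Doherty–Parrilo–Spedalieri relaxation of the cone of separable bipartite states on $\mathbb C^n\otimes\mathbb C^n$, written in moment form, has for generic states one block indexed by each set $I_{1,s'}$,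 of size $|I_{1,s'}|$ (generic regime). A bipartite state $\rho$ is local diagonal orthogonal invariant (LDOI) if $\rho=(O\otimes O)\rho(O\otimes O)^*$ for every diagonal matrix $O$ with diagonal entries in $\{\pm1\}$. For LDOI states the block indexed by $I_{1,s'}$ splits further into sub-blocks indexed by the classes of elements $(\alpha,\beta,\beta')$ having the same $\alpha+\beta+\beta'$ modulo 2, and $N_{s',t}$ is the largest size of such a sub-block (LDOI regime).
   Formalization: The ratio of the largest block sizes, (max N)/(max |I|), is shown to be at most max N/|I| rather than equal to it ("is given by"); equality fails e.g. for n=3, t=2 (7/27 versus 5/18). All displayed inequalities are as stated. *)

theory Defs
  imports Complex_Main "HOL-Number_Theory.Cong"
begin

text \<open>Vectors in \<open>\<nat>\<^sup>n\<close> are functions \<open>nat \<Rightarrow> nat\<close> on the indices \<open>0, \<dots>, n - 1\<close>, with the value 0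
  elsewhere, so that every vector has exactly one representative and cardinalities are correct.\<close>

definition nvecs :: "nat \<Rightarrow> (nat \<Rightarrow> nat) set" where
  "nvecs n = {v. \<forall>i\<ge>n. v i = 0}"

definition vsize :: "nat \<Rightarrow> (nat \<Rightarrow> nat) \<Rightarrow> nat" where
  "vsize n v = (\<Sum>i<n. v i)"

definition vcong2 :: "nat \<Rightarrow> (nat \<Rightarrow> nat) \<Rightarrow> (nat \<Rightarrow> nat) \<Rightarrow> bool" where
  "vcong2 n u v \<longleftrightarrow> (\<forall>i<n. [u i = v i] (mod 2))"

type_synonym vec_triple = "(nat \<Rightarrow> nat) \<times> (nat \<Rightarrow> nat) \<times> (nat \<Rightarrow> nat)"

definition triple_sum :: "vec_triple \<Rightarrow> nat \<Rightarrow> nat" where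
  "triple_sum = (\<lambda>(\<alpha>, \<beta>, \<beta>') i. \<alpha> i + \<beta> i + \<beta>' i)"

definition s_range :: "nat \<Rightarrow> int set" where
  "s_range t = {s. - int t \<le> s \<and> s \<le> int t \<and> [s = int t] (mod 2)}"

definition I1 :: "nat \<Rightarrow> nat \<Rightarrow> int \<Rightarrow> vec_triple set" where
  "I1 n t s = {(\<alpha>, \<beta>, \<beta>'). \<alpha> \<in> nvecs n \<and> \<beta> \<in> nvecs n \<and> \<beta>' \<in> nvecs n \<and>
     vsize n \<alpha> = 1 \<and> vsize n (\<lambda>i. \<beta> i + \<beta>' i) = t \<and>
     int (vsize n \<beta>) - int (vsize n \<beta>') = s}"

definition ldoi_class :: "nat \<Rightarrow> nat \<Rightarrow> int \<Rightarrow> vec_triple \<Rightarrow> vec_triple set" where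
  "ldoi_class n t s x = {y \<in> I1 n t s. vcong2 n (triple_sum y) (triple_sum x)}"

definition N_max :: "nat \<Rightarrow> nat \<Rightarrow> int \<Rightarrow> nat" where
  "N_max n t s = (MAX x\<in>I1 n t s. card (ldoi_class n t s x))"

definition block_ratio :: "nat \<Rightarrow> nat \<Rightarrow> int \<Rightarrow> real" where
  "block_ratio n t s = real (N_max n t s) / real (card (I1 n t s))"

text \<open>For \<open>s \<in> s_range t\<close> the number \<open>t + \<bar>s\<bar>\<close> is even, so the integer division is exact.\<close>

definition ratio_bound :: "nat \<Rightarrow> nat \<Rightarrow> int \<Rightarrow> real" where
  "ratio_bound n t s =
     fact (nat ((int t + \<bar>s\<bar>) div 2)) / real n ^ nat \<lceil>real_of_int (int t + \<bar>s\<bar>) / 4\<rceil>"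

text \<open>The maxima above are over finite nonempty sets.\<close>

lemma finite_s_range: "finite (s_range t)"
  by (rule finite_subset[of _ "{- int t..int t}"]) (auto simp: s_range_def)

lemma s_range_nonempty: "s_range t \<noteq> {}"
proof -
  have "int t \<in> s_range t" by (simp add: s_range_def)
  then show ?thesis by blast
qed

lemma finite_nvecs_bounded: "finite {v \<in> nvecs n. vsize n v \<le> k}"
proof (rule finite_subset)
  show "{v \<in> nvecs n. vsize n v \<le> k} \<subseteq>
      {v. \<forall>i. (i \<in> {..<n} \<longrightarrow> v i \<in> {..k}) \<and> (i \<notin> {..<n} \<longrightarrow> v i = 0)}"
  proof (clarsimp simp: nvecs_def vsize_def)
    fix v :: "nat \<Rightarrow> nat" and i
    assume "sum v {..<n} \<le> k" "i < n"
    then show "v i \<le> k"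
      using member_le_sum[of i "{..<n}" v] by simp
  qed
  show "finite {v. \<forall>i. (i \<in> {..<n} \<longrightarrow> v i \<in> {..k}) \<and> (i \<notin> {..<n} \<longrightarrow> v i = (0::nat))}"
    by (rule finite_set_of_finite_funs) auto
qed

lemma finite_I1: "finite (I1 n t s)"
proof (rule finite_subset)
  let ?V = "\<lambda>k. {v \<in> nvecs n. vsize n v \<le> k}"
  show "I1 n t s \<subseteq> ?V 1 \<times> ?V t \<times> ?V t"
    by (auto simp: I1_def vsize_def sum.distrib)
  show "finite (?V 1 \<times> ?V t \<times> ?V t)"
    by (intro finite_cartesian_product finite_nvecs_bounded)
qed

lemma I1_nonempty:
  assumes "n \<ge> 1" and "s \<in> s_range t"
  shows "I1 n t s \<noteq> {}"
proof -
  define e where "e = (\<lambda>k i. if i = (0::nat) then (k::nat) else 0)"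
  have e: "e k \<in> nvecs n" "vsize n (e k) = k" for k
    using assms(1) by (auto simp: nvecs_def vsize_def e_def sum.delta)
  from assms(2) have b: "- int t \<le> s" "s \<le> int t" and "even (int t - s)"
    by (auto simp: s_range_def cong_iff_dvd_diff dvd_diff_commute)
  then obtain d where d: "int t - s = 2 * d" by blast
  have "vsize n (\<lambda>i. e j i + e k i) = j + k" for j k
    using e(2)[of j] e(2)[of k] by (simp add: vsize_def sum.distrib)
  then have "(e 1, e (nat (int t - d)), e (nat d)) \<in> I1 n t s"
    using e b d by (auto simp: I1_def)
  then show ?thesis by blast
qed

end

theory Submission imports Defs begin

text \<open>
  Write \<open>p = (t + |s'|) / 2\<close> for the larger of \<open>|\<beta>|\<close>, \<open>|\<beta>'|\<close>, and \<open>a\<^sub>k\<close> for the number of vectors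
  of size \<open>k\<close>. Fix a residue class and all components of a triple except the larger one. The parity
  of the remaining vector is then determined, so that vector is determined by its entrywise half,
  which has size at most \<open>p div 2\<close>. Hence the ratio is at most \<open>a\<^bsub>p div 2\<^esub> / a\<^sub>p\<close>. Adding a unit
  vector in all possible ways gives \<open>n * a\<^sub>k \<le> (k + 1) * a\<^bsub>k+1\<^esub>\<close>, and iterating this from
  \<open>p div 2\<close> to \<open>p\<close> yields the bound, since \<open>p - p div 2\<close> is the exponent in the statement.
\<close>

section \<open>Growth of the number of vectors of a given size\<close>

lemma card_le_mult_card_fibres:
  assumes "finite S" "finite T" "f ` S \<subseteq> T"
    and "\<And>y. y \<in> T \<Longrightarrow> card {x \<in> S. f x = y} \<le> k"
  shows "card S \<le> k * card T"
proof -
  have "card S = (\<Sum>y\<in>T. card {x \<in> S. f x = y})"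
    using sum.group[OF assms(1-3), of "\<lambda>_. 1::nat"] by simp
  also have "\<dots> \<le> (\<Sum>y\<in>T. k)"
    using assms(4) by (rule sum_mono)
  finally show ?thesis by (simp add: mult.commute)
qed

definition nvecs_of_size :: "nat \<Rightarrow> nat \<Rightarrow> (nat \<Rightarrow> nat) set" where
  "nvecs_of_size n k = {v \<in> nvecs n. vsize n v = k}"

lemma finite_nvecs_of_size: "finite (nvecs_of_size n k)"
  by (rule finite_subset[OF _ finite_nvecs_bounded[of n k]]) (auto simp: nvecs_of_size_def)

lemma vsize_upd_Suc:
  assumes "i < n"
  shows "vsize n (v(i := Suc (v i))) = Suc (vsize n v)"
proof -
  have "vsize n (v(i := Suc (v i))) = (\<Sum>j<n. v j + (if j = i then 1 else 0))"
    unfolding vsize_def by (rule sum.cong) auto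
  then show ?thesis
    using assms by (simp add: sum.distrib vsize_def)
qed

lemma upd_Suc_in_nvecs_of_size:
  assumes "i < n" "v \<in> nvecs_of_size n k"
  shows "v(i := Suc (v i)) \<in> nvecs_of_size n (Suc k)"
  using assms by (auto simp: nvecs_of_size_def vsize_upd_Suc nvecs_def)

lemma card_support_le_vsize: "card {i. i < n \<and> v i \<noteq> 0} \<le> vsize n v"
proof -
  have "card {i. i < n \<and> v i \<noteq> 0} = (\<Sum>i\<in>{i. i < n \<and> v i \<noteq> 0}. 1)" by simp
  also have "\<dots> \<le> (\<Sum>i\<in>{i. i < n \<and> v i \<noteq> 0}. v i)" by (rule sum_mono) auto
  also have "\<dots> \<le> (\<Sum>i<n. v i)" by (rule sum_mono2) auto
  finally show ?thesis by (simp add: vsize_def)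
qed

text \<open>Double counting of the pairs \<open>(i, v)\<close> under incrementing \<open>v\<close>
  at \<open>i\<close>. In the fibre over \<open>w\<close> the index \<open>i\<close> determines
  \<open>v\<close>, and \<open>i\<close> lies in the support of \<open>w\<close>, which has at most
  \<open>Suc k\<close> elements.\<close>

lemma card_nvecs_of_size_Suc_ge:
  "n * card (nvecs_of_size n k) \<le> Suc k * card (nvecs_of_size n (Suc k))"
proof -
  let ?f = "\<lambda>(i, v). v(i := Suc (v i))"
  let ?S = "{..<n} \<times> nvecs_of_size n k"
  have "card ?S \<le> Suc k * card (nvecs_of_size n (Suc k))"
  proof (rule card_le_mult_card_fibres[where f = ?f])
    show "finite ?S" using finite_nvecs_of_size by simp
    show "finite (nvecs_of_size n (Suc k))" by (rule finite_nvecs_of_size)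
    show "?f ` ?S \<subseteq> nvecs_of_size n (Suc k)"
      using upd_Suc_in_nvecs_of_size by auto
  next
    fix w assume w: "w \<in> nvecs_of_size n (Suc k)"
    have "inj_on fst {x \<in> ?S. ?f x = w}"
    proof (rule inj_onI, clarsimp)
      fix i u v assume eq: "u(i := Suc (u i)) = v(i := Suc (v i))"
      show "v = u"
      proof
        fix j show "v j = u j"
          using fun_cong[OF eq, of j] by (cases "j = i") auto
      qed
    qed
    moreover have "fst ` {x \<in> ?S. ?f x = w} \<subseteq> {i. i < n \<and> w i \<noteq> 0}" by auto
    ultimately have "card {x \<in> ?S. ?f x = w} \<le> card {i. i < n \<and> w i \<noteq> 0}"
      by (rule card_inj_on_le) simp
    also have "\<dots> \<le> Suc k"
      using card_support_le_vsize[of n w] w by (simp add: nvecs_of_size_def)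
    finally show "card {x \<in> ?S. ?f x = w} \<le> Suc k" .
  qed
  then show ?thesis by (simp add: card_cartesian_product)
qed

text \<open>The \<open>d\<close> increments from size \<open>m\<close> cost the factor
  \<open>(m + 1) * ... * (m + d)\<close>; the full factorial is a cruder bound that still passes
  through the induction.\<close>

lemma power_mult_card_nvecs_of_size_le:
  "n ^ d * card (nvecs_of_size n m) \<le> fact (m + d) * card (nvecs_of_size n (m + d))"
proof (induction d)
  case 0
  show ?case by simp
next
  case (Suc d)
  have "n ^ Suc d * card (nvecs_of_size n m)
      \<le> fact (m + d) * (n * card (nvecs_of_size n (m + d)))"
    using mult_le_mono2[OF Suc.IH, of n] by (simp add: ac_simps)
  also have "\<dots> \<le> fact (m + d) * (Suc (m + d) * card (nvecs_of_size n (Suc (m + d))))"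
    by (intro mult_le_mono2 card_nvecs_of_size_Suc_ge)
  finally show ?case by (simp add: algebra_simps)
qed

text \<open>Incrementing entry 0, which exists as \<open>n \<ge> 1\<close>, embeds each size into
  the next. This absorbs the number of odd entries when parity classes are counted below.\<close>

lemma card_nvecs_of_size_mono:
  assumes "n \<ge> 1" "k \<le> m"
  shows "card (nvecs_of_size n k) \<le> card (nvecs_of_size n m)"
  using assms(2)
proof (rule lift_Suc_mono_le[rotated])
  fix k
  show "card (nvecs_of_size n k) \<le> card (nvecs_of_size n (Suc k))"
  proof (rule card_inj_on_le[OF _ _ finite_nvecs_of_size])
    show "inj_on (\<lambda>v. v(0 := Suc (v 0))) (nvecs_of_size n k)"
    proof (rule inj_onI)
      fix u v :: "nat \<Rightarrow> nat" assume eq: "u(0 := Suc (u 0)) = v(0 := Suc (v 0))"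
      show "u = v"
      proof
        fix j show "u j = v j"
          using fun_cong[OF eq, of j] by (cases "j = 0") auto
      qed
    qed
    show "(\<lambda>v. v(0 := Suc (v 0))) ` nvecs_of_size n k \<subseteq> nvecs_of_size n (Suc k)"
      using assms(1) by (auto intro!: upd_Suc_in_nvecs_of_size)
  qed
qed

section \<open>Residue classes modulo 2\<close>

lemma card_nvecs_of_size_parity_class_le:
  assumes "n \<ge> 1"
  shows "card {v \<in> nvecs_of_size n p. vcong2 n v d} \<le> card (nvecs_of_size n (p div 2))"
proof -
  let ?C = "{v \<in> nvecs_of_size n p. vcong2 n v d}"
  \<comment> \<open>\<open>r\<close> counts the odd entries of \<open>d\<close> below
    \<open>n\<close>. Every \<open>v\<close> in the class has the same number of them, so its
    entrywise half has size exactly \<open>(p - r) div 2\<close>.\<close>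
  define r where "r = (\<Sum>i<n. d i mod 2)"
  have half: "(\<lambda>i. v i div 2) \<in> nvecs_of_size n ((p - r) div 2)" if "v \<in> ?C" for v
  proof -
    have "p = (\<Sum>i<n. 2 * (v i div 2) + d i mod 2)"
      using that by (auto simp: nvecs_of_size_def vsize_def vcong2_def cong_def intro!: sum.cong)
        (metis lessThan_iff mult_div_mod_eq)
    then have "p = 2 * (\<Sum>i<n. v i div 2) + r"
      by (simp add: sum.distrib sum_distrib_left r_def)
    then show ?thesis
      using that by (auto simp: nvecs_of_size_def vsize_def nvecs_def)
  qed
  have "inj_on (\<lambda>v i. v i div 2) ?C"
  proof (rule inj_onI)
    fix u v assume u: "u \<in> ?C" and v: "v \<in> ?C" and eq: "(\<lambda>i. u i div 2) = (\<lambda>i. v i div 2)"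
    show "u = v"
    proof
      fix i
      \<comment> \<open>Below \<open>n\<close> both parities are that of \<open>d i\<close>; from
        \<open>n\<close> on both entries are 0. Parity and half together determine the
        entry.\<close>
      have "u i mod 2 = v i mod 2"
        using u v by (cases "i < n") (auto simp: nvecs_of_size_def nvecs_def vcong2_def cong_def)
      with fun_cong[OF eq, of i] show "u i = v i" by (metis mult_div_mod_eq)
    qed
  qed
  then have "card ?C \<le> card (nvecs_of_size n ((p - r) div 2))"
    using half by (intro card_inj_on_le[OF _ _ finite_nvecs_of_size]) auto
  also have "\<dots> \<le> card (nvecs_of_size n (p div 2))"
    by (intro card_nvecs_of_size_mono assms div_le_mono) simp
  finally show ?thesis .
qed

text \<open>Sum and difference of \<open>|\<beta>|\<close> and \<open>|\<beta>'|\<close> fix both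
  sizes, so the block index set is a full product.\<close>

lemma I1_eq_Times:
  assumes "int a + int b = int t" "int a - int b = s"
  shows "I1 n t s = nvecs_of_size n 1 \<times> nvecs_of_size n a \<times> nvecs_of_size n b"
proof -
  have "vsize n (\<lambda>i. \<beta> i + \<beta>' i) = vsize n \<beta> + vsize n \<beta>'" for \<beta> \<beta>'
    by (simp add: vsize_def sum.distrib)
  then show ?thesis
    using assms by (auto simp: I1_def nvecs_of_size_def)
qed

lemma card_parity_class_Times_le:
  assumes "n \<ge> 1" "finite U" "finite V"
  shows "card {(u, v, w) \<in> U \<times> nvecs_of_size n p \<times> V. vcong2 n (\<lambda>i. u i + v i + w i) c}
    \<le> card (nvecs_of_size n (p div 2)) * (card U * card V)"
proof -
  let ?S = "{(u, v, w) \<in> U \<times> nvecs_of_size n p \<times> V. vcong2 n (\<lambda>i. u i + v i + w i) c}"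
  have "card ?S \<le> card (nvecs_of_size n (p div 2)) * card (U \<times> V)"
  proof (rule card_le_mult_card_fibres[where f = "\<lambda>(u, v, w). (u, w)"])
    show "finite ?S"
      by (rule finite_subset[of _ "U \<times> nvecs_of_size n p \<times> V"])
        (use assms finite_nvecs_of_size in auto)
    show "finite (U \<times> V)" using assms by simp
    show "(\<lambda>(u, v, w). (u, w)) ` ?S \<subseteq> U \<times> V" by auto
  next
    fix y assume "y \<in> U \<times> V"
    obtain u w where y: "y = (u, w)" by (cases y)
    \<comment> \<open>Modulo 2, subtracting \<open>u\<close> and \<open>w\<close> is the same as
      adding them, which avoids truncated subtraction on naturals.\<close>
    let ?D = "{v \<in> nvecs_of_size n p. vcong2 n v (\<lambda>i. c i + u i + w i)}"
    have parity: "vcong2 n v (\<lambda>i. c i + u i + w i)"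
      if "vcong2 n (\<lambda>i. u i + v i + w i) c" for v
    proof -
      have "v i mod 2 = (c i + u i + w i) mod 2" if "(u i + v i + w i) mod 2 = c i mod 2" for i
        using that by presburger
      then show ?thesis
        using that by (simp add: vcong2_def cong_def)
    qed
    have "{x \<in> ?S. (\<lambda>(u, v, w). (u, w)) x = y} \<subseteq> (\<lambda>v. (u, v, w)) ` ?D"
      using parity y by auto
    then have "card {x \<in> ?S. (\<lambda>(u, v, w). (u, w)) x = y} \<le> card ?D"
      by (rule surj_card_le[rotated]) (simp add: finite_nvecs_of_size)
    also have "\<dots> \<le> card (nvecs_of_size n (p div 2))"
      by (rule card_nvecs_of_size_parity_class_le[OF assms(1)])
    finally show "card {x \<in> ?S. (\<lambda>(u, v, w). (u, w)) x = y}
      \<le> card (nvecs_of_size n (p div 2))" .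
  qed
  then show ?thesis by (simp add: card_cartesian_product)
qed

lemma card_ldoi_class_mult_le:
  assumes "n \<ge> 1" "s \<in> s_range t" and p: "2 * int p = int t + \<bar>s\<bar>"
  shows "n ^ (p - p div 2) * card (ldoi_class n t s x) \<le> fact p * card (I1 n t s)"
proof -
  let ?A = "\<lambda>k. card (nvecs_of_size n k)"
  have "int p \<le> int t"
    using assms by (auto simp: s_range_def)
  then obtain q where q: "t = p + q"
    by (metis le_iff_add of_nat_le_iff)
  let ?c = "triple_sum x"
  have "card (ldoi_class n t s x) \<le> ?A (p div 2) * (?A 1 * ?A q)
      \<and> card (I1 n t s) = ?A 1 * ?A p * ?A q"
  \<comment> \<open>The sign of \<open>s\<close> decides which of \<open>\<beta>\<close> and
    \<open>\<beta>'\<close> has the larger size \<open>p\<close>. For negative \<open>s\<close> the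
    two are swapped, which preserves the triple sum.\<close>
  proof (cases "s \<ge> 0")
    case True
    then have I: "I1 n t s = nvecs_of_size n 1 \<times> nvecs_of_size n p \<times> nvecs_of_size n q"
      using p q by (intro I1_eq_Times) auto
    have "ldoi_class n t s x = {(u, v, w) \<in> nvecs_of_size n 1 \<times> nvecs_of_size n p
        \<times> nvecs_of_size n q. vcong2 n (\<lambda>i. u i + v i + w i) ?c}"
      by (auto simp: ldoi_class_def I triple_sum_def)
    then have "card (ldoi_class n t s x) \<le> ?A (p div 2) * (?A 1 * ?A q)"
      by (simp only: card_parity_class_Times_le[OF assms(1) finite_nvecs_of_size finite_nvecs_of_size])
    then show ?thesis
      by (simp add: I card_cartesian_product)
  next
    case False
    then have I: "I1 n t s = nvecs_of_size n 1 \<times> nvecs_of_size n q \<times> nvecs_of_size n p"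
      using p q by (intro I1_eq_Times) auto
    let ?S = "{(u, v, w) \<in> nvecs_of_size n 1 \<times> nvecs_of_size n p
        \<times> nvecs_of_size n q. vcong2 n (\<lambda>i. u i + v i + w i) ?c}"
    have "finite ?S"
      by (rule finite_subset[of _ "nvecs_of_size n 1 \<times> nvecs_of_size n p \<times> nvecs_of_size n q"])
        (use finite_nvecs_of_size in auto)
    moreover have "ldoi_class n t s x \<subseteq> (\<lambda>(u, v, w). (u, w, v)) ` ?S"
      by (force simp: ldoi_class_def I triple_sum_def ac_simps image_iff)
    ultimately have "card (ldoi_class n t s x) \<le> card ?S"
      by (rule surj_card_le)
    also have "\<dots> \<le> ?A (p div 2) * (?A 1 * ?A q)"
      by (rule card_parity_class_Times_le[OF assms(1) finite_nvecs_of_size finite_nvecs_of_size])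
    finally show ?thesis
      by (simp add: I card_cartesian_product ac_simps)
  qed
  then have le: "card (ldoi_class n t s x) \<le> ?A (p div 2) * (?A 1 * ?A q)"
    and card_I: "card (I1 n t s) = ?A 1 * ?A p * ?A q" by auto
  have "n ^ (p - p div 2) * card (ldoi_class n t s x)
      \<le> n ^ (p - p div 2) * ?A (p div 2) * (?A 1 * ?A q)"
    unfolding mult.assoc by (rule mult_le_mono2[OF le])
  \<comment> \<open>Growth from size \<open>p div 2\<close> to size \<open>p\<close>; the factors
    for the other two components are common to both sides.\<close>
  also have "\<dots> \<le> fact p * ?A p * (?A 1 * ?A q)"
    using power_mult_card_nvecs_of_size_le[of n "p - p div 2" "p div 2"] by (intro mult_le_mono1) simp
  finally show ?thesis by (simp add: card_I ac_simps)
qed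

section \<open>Passage to ratios and maxima\<close>

lemma card_I1_pos:
  assumes "n \<ge> 1" "s \<in> s_range t"
  shows "card (I1 n t s) > 0"
  using I1_nonempty[OF assms] finite_I1 by (simp add: card_gt_0_iff)

lemma block_ratio_le_ratio_bound:
  assumes "n \<ge> 1" "s \<in> s_range t"
  shows "block_ratio n t s \<le> ratio_bound n t s"
proof -
  have "even (int t + \<bar>s\<bar>)"
    using assms(2) by (auto simp: s_range_def cong_def)
  define p where "p = nat ((int t + \<bar>s\<bar>) div 2)"
  have p: "2 * int p = int t + \<bar>s\<bar>"
    using \<open>even (int t + \<bar>s\<bar>)\<close> by (simp add: p_def)
  have "N_max n t s \<in> (\<lambda>x. card (ldoi_class n t s x)) ` I1 n t s"
    unfolding N_max_def using I1_nonempty[OF assms] finite_I1 by (intro Max_in) auto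
  then obtain x where x: "N_max n t s = card (ldoi_class n t s x)" by auto
  have exponent: "nat \<lceil>real_of_int (int t + \<bar>s\<bar>) / 4\<rceil> = p - p div 2"
  proof -
    \<comment> \<open>The quotient is \<open>p / 2\<close>, and \<open>p - p div 2\<close> is
      \<open>p / 2\<close> rounded up.\<close>
    have "\<lceil>real_of_int (int t + \<bar>s\<bar>) / 4\<rceil> = int (p - p div 2)"
      unfolding p[symmetric] by (rule ceiling_unique) linarith+
    then show ?thesis by simp
  qed
  have "real (n ^ (p - p div 2) * N_max n t s) \<le> real (fact p * card (I1 n t s))"
    unfolding x using card_ldoi_class_mult_le[OF assms p] by (rule of_nat_mono)
  then have "block_ratio n t s \<le> fact p / real n ^ (p - p div 2)"
    using assms(1) card_I1_pos[OF assms] by (simp add: block_ratio_def field_simps)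
  then show ?thesis
    unfolding ratio_bound_def exponent p_def[symmetric] .
qed

text \<open>Numerator and denominator are estimated separately: \<open>\<bar>s\<bar> \<le> t\<close>
  bounds the factorial, and \<open>\<bar>s\<bar> \<ge> 0\<close> bounds the exponent from
  below.\<close>

lemma ratio_bound_le:
  assumes "n \<ge> 1" "s \<in> s_range t"
  shows "ratio_bound n t s \<le> fact t / real n ^ nat \<lceil>real t / 4\<rceil>"
  unfolding ratio_bound_def
proof (rule frac_le)
  show "fact (nat ((int t + \<bar>s\<bar>) div 2)) \<le> (fact t :: real)"
    using assms(2) by (intro fact_mono) (auto simp: s_range_def)
  show "real n ^ nat \<lceil>real t / 4\<rceil> \<le> real n ^ nat \<lceil>real_of_int (int t + \<bar>s\<bar>) / 4\<rceil>"
    using assms(1) by (intro power_increasing nat_mono ceiling_mono) auto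
qed (use assms(1) in auto)

theorem lemma5p4:
  fixes n t :: nat
  assumes "n \<ge> 1" and "t \<ge> 1"
  shows "(\<forall>s\<in>s_range t. block_ratio n t s \<le> ratio_bound n t s) \<and>
    real (MAX s\<in>s_range t. N_max n t s) / real (MAX s\<in>s_range t. card (I1 n t s))
      \<le> (MAX s\<in>s_range t. block_ratio n t s) \<and>
    (MAX s\<in>s_range t. block_ratio n t s) \<le> (MAX s\<in>s_range t. ratio_bound n t s) \<and>
    (MAX s\<in>s_range t. ratio_bound n t s) \<le> fact t / real n ^ nat \<lceil>real t / 4\<rceil>"
proof (intro conjI ballI)
  fix s assume "s \<in> s_range t"
  then show "block_ratio n t s \<le> ratio_bound n t s"
    by (rule block_ratio_le_ratio_bound[OF assms(1)])
next
  \<comment> \<open>The ratio of the maxima is at most the maximum of the ratios: at an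
    \<open>s\<close> attaining the largest \<open>N_max\<close>, replacing the largest generic block
    by the one at \<open>s\<close> only shrinks the denominator.\<close>
  have "(MAX s\<in>s_range t. N_max n t s) \<in> N_max n t ` s_range t"
    using s_range_nonempty finite_s_range by (intro Max_in) auto
  then obtain s where s: "s \<in> s_range t" "(MAX s\<in>s_range t. N_max n t s) = N_max n t s" by auto
  have "card (I1 n t s) \<le> (MAX s\<in>s_range t. card (I1 n t s))"
    using s(1) finite_s_range by (intro Max_ge) auto
  then have "real (N_max n t s) / real (MAX s\<in>s_range t. card (I1 n t s)) \<le> block_ratio n t s"
    unfolding block_ratio_def using card_I1_pos[OF assms(1) s(1)] by (intro frac_le) auto
  also have "\<dots> \<le> (MAX s\<in>s_range t. block_ratio n t s)"
    using s(1) finite_s_range by (intro Max_ge) auto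
  finally show "real (MAX s\<in>s_range t. N_max n t s) / real (MAX s\<in>s_range t. card (I1 n t s))
      \<le> (MAX s\<in>s_range t. block_ratio n t s)"
    unfolding s(2) .
next
  have "block_ratio n t s \<le> (MAX s\<in>s_range t. ratio_bound n t s)" if "s \<in> s_range t" for s
    using block_ratio_le_ratio_bound[OF assms(1) that] that finite_s_range
    by (meson Max_ge finite_imageI image_eqI order_trans)
  then show "(MAX s\<in>s_range t. block_ratio n t s) \<le> (MAX s\<in>s_range t. ratio_bound n t s)"
    using s_range_nonempty finite_s_range by (intro Max.boundedI) auto
next
  show "(MAX s\<in>s_range t. ratio_bound n t s) \<le> fact t / real n ^ nat \<lceil>real t / 4\<rceil>"
    using s_range_nonempty finite_s_range ratio_bound_le[OF assms(1)]
    by (intro Max.boundedI) auto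
qed

end
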